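(* Let $0<a<1$ and $\phi_a(z)=az+(1-a)$. For any $b>0$ and any non-zero $f\in E_b$, the cyclic subspace $K_f$ is not a minimal invariant subspace for $C_{\phi_a}$.
   Context: $H^2=H^2(\mathbb{D})$ is the Hardy space of the open unit disk $\mathbb{D}$. For $b>0$, $E_b=\left\{e^{b\frac{z+1}{z-1}}h(z):h\in H^2\right\}$ is the singular shift-invariant subspace. $C_{\phi_a}f=f\circ\phi_a$ is a bounded operator on $H^2$. For non-zero $f\in H^2$, $K_f=\overline{\mathrm{span}\{C_{\phi_a}^n f:n\ge0\}}^{H^2}$. An invariant subspace is a closed subspace mapped into itself; it is minimal if it is non-zero and contains no invariant subspaces other than $\{0\}$ and itself. *)

theory Defs
  imports "HOL-Complex_Analysis.Complex_Analysis" "HOL-Library.Function_Algebras"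
begin

interpretation cfun: vector_space "\<lambda>(c::complex) (f :: complex \<Rightarrow> complex) z. c * f z"
  by unfold_locales (auto simp: fun_eq_iff algebra_simps)

text \<open>
  An element of the Hardy space is represented by the function on the whole plane that extends it
  by zero outside the open unit disk, so that equality in the space is equality of functions.
\<close>

abbreviation unit_disk :: "complex set" where
  "unit_disk \<equiv> ball 0 1"

definition taylor_coeff :: "(complex \<Rightarrow> complex) \<Rightarrow> nat \<Rightarrow> complex" where
  "taylor_coeff f n = fps_nth (fps_expansion f 0) n"

definition hardy_space :: "(complex \<Rightarrow> complex) set" where
  "hardy_space = {f. f holomorphic_on unit_disk \<and> (\<forall>z. z \<notin> unit_disk \<longrightarrow> f z = 0) \<and>
                     summable (\<lambda>n. (cmod (taylor_coeff f n))\<^sup>2)}"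

definition hardy_norm :: "(complex \<Rightarrow> complex) \<Rightarrow> real" where
  "hardy_norm f = sqrt (\<Sum>n. (cmod (taylor_coeff f n))\<^sup>2)"

text \<open>
  The value outside the Hardy space is irrelevant; it is fixed because the locale
  \<^locale>\<open>Metric_space\<close> wants symmetry and nonnegativity on the whole type.
\<close>

definition hardy_dist :: "(complex \<Rightarrow> complex) \<Rightarrow> (complex \<Rightarrow> complex) \<Rightarrow> real" where
  "hardy_dist f g = (if f \<in> hardy_space \<and> g \<in> hardy_space then hardy_norm (f - g) else 0)"

lemma taylor_coeff_diff:
  assumes "f holomorphic_on unit_disk" "g holomorphic_on unit_disk"
  shows "taylor_coeff (f - g) n = taylor_coeff f n - taylor_coeff g n"
proof -
  have "(deriv ^^ n) (\<lambda>w. f w - g w) 0 = (deriv ^^ n) f 0 - (deriv ^^ n) g 0"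
    using assms by (intro higher_deriv_diff[where S = unit_disk]) auto
  moreover have "f - g = (\<lambda>w. f w - g w)"
    by (simp add: fun_eq_iff)
  ultimately show ?thesis
    by (simp add: taylor_coeff_def fps_expansion_def diff_divide_distrib)
qed

lemma l2_triangle:
  fixes u v :: "nat \<Rightarrow> complex"
  assumes u: "summable (\<lambda>n. (cmod (u n))\<^sup>2)" and v: "summable (\<lambda>n. (cmod (v n))\<^sup>2)"
  shows "summable (\<lambda>n. (cmod (u n + v n))\<^sup>2)"
    and "sqrt (\<Sum>n. (cmod (u n + v n))\<^sup>2) \<le>
         sqrt (\<Sum>n. (cmod (u n))\<^sup>2) + sqrt (\<Sum>n. (cmod (v n))\<^sup>2)" (is "_ \<le> ?R")
proof -
  have fin: "(\<Sum>n<N. (cmod (u n + v n))\<^sup>2) \<le> ?R\<^sup>2" for N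
  proof -
    have "L2_set (\<lambda>n. cmod (u n + v n)) {..<N} \<le> L2_set (\<lambda>n. cmod (u n) + cmod (v n)) {..<N}"
      by (intro L2_set_mono norm_triangle_ineq) auto
    also have "\<dots> \<le> L2_set (\<lambda>n. cmod (u n)) {..<N} + L2_set (\<lambda>n. cmod (v n)) {..<N}"
      by (rule L2_set_triangle_ineq)
    also have "\<dots> \<le> ?R"
      unfolding L2_set_def
      by (intro add_mono real_sqrt_le_mono sum_le_suminf u v) auto
    finally have "sqrt (\<Sum>n<N. (cmod (u n + v n))\<^sup>2) \<le> ?R"
      by (simp add: L2_set_def)
    then show ?thesis
      by (rule sqrt_le_D)
  qed
  show s: "summable (\<lambda>n. (cmod (u n + v n))\<^sup>2)"
    using fin by (intro summableI_nonneg_bounded) auto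
  have "(\<Sum>n. (cmod (u n + v n))\<^sup>2) \<le> ?R\<^sup>2"
    using fin s by (intro suminf_le_const) auto
  moreover have "0 \<le> ?R"
    using u v by (intro add_nonneg_nonneg real_sqrt_ge_zero suminf_nonneg) auto
  ultimately show "sqrt (\<Sum>n. (cmod (u n + v n))\<^sup>2) \<le> ?R"
    by (rule real_le_lsqrt[rotated 1])
qed

lemma hardy_space_diff:
  assumes f: "f \<in> hardy_space" and g: "g \<in> hardy_space"
  shows "f - g \<in> hardy_space"
proof -
  have "summable (\<lambda>n. (cmod (taylor_coeff f n + - taylor_coeff g n))\<^sup>2)"
    using f g by (intro l2_triangle) (auto simp: hardy_space_def)
  moreover have "f - g = (\<lambda>z. f z - g z)"
    by (simp add: fun_eq_iff)
  ultimately show ?thesis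
    using f g taylor_coeff_diff[of f g]
    by (auto simp: hardy_space_def intro!: holomorphic_intros)
qed

lemma hardy_norm_eq_0_imp:
  assumes f: "f \<in> hardy_space" and 0: "hardy_norm f = 0"
  shows "f = 0"
proof
  fix z
  have sm: "summable (\<lambda>n. (cmod (taylor_coeff f n))\<^sup>2)" and hol: "f holomorphic_on unit_disk"
    using f by (auto simp: hardy_space_def)
  have "(\<Sum>n. (cmod (taylor_coeff f n))\<^sup>2) = 0"
    using 0 by (simp add: hardy_norm_def)
  then have "(deriv ^^ n) f 0 = 0" for n
    using suminf_eq_zero_iff[OF sm] by (simp add: taylor_coeff_def fps_expansion_def)
  then show "f z = 0 z"
  proof (cases "z \<in> unit_disk")
    case True
    then have "(\<lambda>n. (deriv ^^ n) f 0 / fact n * (z - 0) ^ n) sums f z"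
      using hol by (intro holomorphic_power_series) auto
    then show ?thesis
      using \<open>\<And>n. (deriv ^^ n) f 0 = 0\<close> sums_unique2[OF _ sums_zero] by simp
  qed (use f in \<open>auto simp: hardy_space_def\<close>)
qed

interpretation hardy: Metric_space hardy_space hardy_dist
proof
  fix f g h
  show "0 \<le> hardy_dist f g"
    using hardy_space_diff[of f g]
    by (auto simp: hardy_dist_def hardy_norm_def hardy_space_def intro!: suminf_nonneg)
  show "hardy_dist f g = hardy_dist g f"
    using taylor_coeff_diff[of f g] taylor_coeff_diff[of g f]
    by (auto simp: hardy_dist_def hardy_norm_def hardy_space_def norm_minus_commute)
  assume f: "f \<in> hardy_space" and g: "g \<in> hardy_space"
  show "hardy_dist f g = 0 \<longleftrightarrow> f = g"
  proof
    assume "hardy_dist f g = 0"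
    then show "f = g"
      using hardy_norm_eq_0_imp[of "f - g"] hardy_space_diff[OF f g] f g
      by (simp add: hardy_dist_def)
  next
    assume "f = g"
    then show "hardy_dist f g = 0"
      using g taylor_coeff_diff[of g g] by (simp add: hardy_dist_def hardy_norm_def hardy_space_def)
  qed
  assume h: "h \<in> hardy_space"
  show "hardy_dist f h \<le> hardy_dist f g + hardy_dist g h"
    using l2_triangle(2)[of "taylor_coeff (f - g)" "taylor_coeff (g - h)"]
      hardy_space_diff[OF f g] hardy_space_diff[OF g h] f g h
    by (simp add: hardy_dist_def hardy_norm_def hardy_space_def taylor_coeff_diff)
qed

definition invariant_subspace ::
    "((complex \<Rightarrow> complex) \<Rightarrow> complex \<Rightarrow> complex) \<Rightarrow> (complex \<Rightarrow> complex) set \<Rightarrow> bool" where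
  "invariant_subspace T M \<longleftrightarrow>
     M \<subseteq> hardy_space \<and> cfun.subspace M \<and> closedin hardy.mtopology M \<and> T ` M \<subseteq> M"

definition minimal_invariant_subspace ::
    "((complex \<Rightarrow> complex) \<Rightarrow> complex \<Rightarrow> complex) \<Rightarrow> (complex \<Rightarrow> complex) set \<Rightarrow> bool" where
  "minimal_invariant_subspace T M \<longleftrightarrow>
     invariant_subspace T M \<and> M \<noteq> {0} \<and>
     (\<forall>N. invariant_subspace T N \<and> N \<subseteq> M \<longrightarrow> N = {0} \<or> N = M)"

definition cyclic_subspace ::
    "((complex \<Rightarrow> complex) \<Rightarrow> complex \<Rightarrow> complex) \<Rightarrow> (complex \<Rightarrow> complex) \<Rightarrow>
     (complex \<Rightarrow> complex) set" where
  "cyclic_subspace T f = hardy.mtopology closure_of (cfun.span {(T ^^ n) f | n. True})"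

definition comp_op :: "(complex \<Rightarrow> complex) \<Rightarrow> (complex \<Rightarrow> complex) \<Rightarrow> complex \<Rightarrow> complex" where
  "comp_op \<phi> f = (\<lambda>z. if z \<in> unit_disk then f (\<phi> z) else 0)"

definition affine_symbol :: "real \<Rightarrow> complex \<Rightarrow> complex" where
  "affine_symbol a z = of_real a * z + (1 - of_real a)"

text \<open>The products below vanish outside the disk because \<open>h\<close> does.\<close>

definition singular_subspace :: "real \<Rightarrow> (complex \<Rightarrow> complex) set" where
  "singular_subspace b =
     {(\<lambda>z. exp (of_real b * ((z + 1) / (z - 1))) * h z) | h. h \<in> hardy_space}"

end

theory Submission
  imports Defs
begin

text \<open>
  Write \<open>S b\<close> for the singular inner function \<open>exp (b * (z + 1) / (z - 1))\<close> and \<open>C\<close> for the composition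
  operator. In the half-plane coordinate \<open>w = (1 + z) / (1 - z)\<close> one has \<open>S b = exp (- b * w)\<close>, and the
  symbol becomes \<open>w / a + (1 - a) / a\<close>. So \<open>C\<close> maps the singular subspace of parameter \<open>b\<close> into the
  one of parameter \<open>b / a\<close>, and all elements of the span of the orbit of \<open>(C ^^ n) f\<close> are divisible by
  \<open>S (b / a ^ n)\<close> (\<open>comp_op_power_singular_subspace\<close>).
  
  Suppose that the cyclic subspace of \<open>f\<close> is minimal. Since \<open>C\<close> is injective
  (\<open>comp_op_affine_injective\<close>) and bounded (\<open>comp_op_hardy\<close>), the cyclic subspace of \<open>(C ^^ n) f\<close> is a
  non-zero invariant subspace of it, hence equal to it and contains \<open>f\<close>. Thus for every \<open>n\<close> the function
  \<open>f\<close> is a limit of functions divisible by \<open>S (b / a ^ n)\<close>.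
  
  This is absurd. Multiplication by \<open>S c\<close> is isometric (\<open>singular_mult_hardy\<close> and
  \<open>hardy_norm_singular_mult\<close>), so a function \<open>g\<close> divisible by \<open>S c\<close> satisfies
  \<open>cmod (g z) \<le> cmod (S c z) * hardy_norm g / (1 - cmod z)\<close>, a bound that passes to limits
  (\<open>singular_closure_eval_bound\<close>). For \<open>c = b / a ^ n\<close> its right-hand side tends to \<open>0\<close> as \<open>n\<close>
  grows, because \<open>S c z\<close> decays exponentially in \<open>c\<close>. Hence \<open>f = 0\<close>.
\<close>

section \<open>Taylor coefficients and circle means\<close>

lemma taylor_coeff_sums:
  assumes "F holomorphic_on unit_disk" "cmod z < 1"
  shows "(\<lambda>n. taylor_coeff F n * z ^ n) sums F z"
  using holomorphic_power_series[of F 0 1 z] assms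
  by (simp add: taylor_coeff_def fps_expansion_def)

text \<open>
  The circle is parametrised by the unit interval, so that this integral is the mean over the
  circle and no factor \<open>1 / (2 * pi)\<close> occurs in Parseval's identity.
\<close>
definition circle_mean :: "real \<Rightarrow> (complex \<Rightarrow> complex) \<Rightarrow> real" where
  "circle_mean r F = integral {0..1} (\<lambda>t. (cmod (F (of_real r * cis (2 * pi * t))))\<^sup>2)"

text \<open>
  Orthonormality of the characters of the circle. The frequency is a difference of naturals because
  it comes from a product \<open>z ^ n * cnj (z ^ m)\<close>.
\<close>
lemma has_integral_cis:
  "((\<lambda>t. cis (2 * pi * (real n - real m) * t)) has_integral (if n = m then 1 else 0)) {0..1}"
proof (cases "n = m")
  case True
  then show ?thesis using has_integral_const_real[of "1::complex" 0 1] by simp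
next
  case False
  define k where "k = 2 * pi * (real n - real m)"
  have k: "k \<noteq> 0" using False by (simp add: k_def)
  have "((\<lambda>t. cis (k * t)) has_integral cis (k * 1) / (\<i> * k) - cis (k * 0) / (\<i> * k)) {0..1}"
    by (intro fundamental_theorem_of_calculus)
       (use k in \<open>auto intro!: derivative_eq_intros simp: has_vector_derivative_def fun_eq_iff
         scaleR_conv_of_real field_simps\<close>)
  moreover have "k * 1 = 2 * pi * of_int (int n - int m)" by (simp add: k_def)
  then have "cis (k * 1) = 1" by (simp only: cis_multiple_2pi[OF Ints_of_int])
  ultimately show ?thesis using False by (simp add: k_def)
qed

text \<open>
  For polynomials Parseval's identity holds on every circle. The radius \<open>1\<close>, where an element of the
  Hardy space need not have values, is what the isometry property below uses.
\<close>
lemma circle_mean_polynomial: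
  "circle_mean r (\<lambda>z. \<Sum>n<N. c n * z ^ n) = (\<Sum>n<N. (cmod (c n))\<^sup>2 * r ^ (2 * n))"
proof -
  let ?P = "\<lambda>t. \<Sum>n<N. c n * (of_real r * cis (2 * pi * t)) ^ n"
  have "?P t * cnj (?P t) = (\<Sum>n<N. \<Sum>m<N. (c n * cnj (c m) * of_real (r ^ (n + m))) *
           cis (2 * pi * (real n - real m) * t))" for t
  proof -
    have *: "cis (2 * pi * (real n - real m) * t) = cis (2 * pi * t) ^ n * cnj (cis (2 * pi * t) ^ m)" for n m
      unfolding Complex.DeMoivre cis_cnj cis_mult by (simp add: algebra_simps)
    show ?thesis
      unfolding * by (simp add: cnj_sum sum_product power_mult_distrib power_add mult_ac)
  qed
  moreover have "((\<lambda>t. \<Sum>n<N. \<Sum>m<N. (c n * cnj (c m) * of_real (r ^ (n + m))) *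
           cis (2 * pi * (real n - real m) * t)) has_integral
         (\<Sum>n<N. \<Sum>m<N. (c n * cnj (c m) * of_real (r ^ (n + m))) * (if n = m then 1 else 0))) {0..1}"
    by (intro has_integral_sum finite_lessThan has_integral_mult_right has_integral_cis)
  moreover have "(\<Sum>n<N. \<Sum>m<N. (c n * cnj (c m) * of_real (r ^ (n + m))) * (if n = m then 1 else 0)) =
     of_real (\<Sum>n<N. (cmod (c n))\<^sup>2 * r ^ (2 * n))"
    by (simp add: if_distrib cong: if_cong) (simp add: mult_2 flip: complex_norm_square)
  ultimately have "((\<lambda>t. complex_of_real ((cmod (?P t))\<^sup>2)) has_integral
       complex_of_real (\<Sum>n<N. (cmod (c n))\<^sup>2 * r ^ (2 * n))) {0..1}"
    by (simp only: complex_norm_square)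
  from has_integral_linear[OF this bounded_linear_Re]
  have "((\<lambda>t. (cmod (?P t))\<^sup>2) has_integral (\<Sum>n<N. (cmod (c n))\<^sup>2 * r ^ (2 * n))) {0..1}"
    by (simp only: o_def Re_complex_of_real)
  then show ?thesis
    by (simp add: circle_mean_def integral_unique)
qed

lemma circle_point: "0 \<le> r \<Longrightarrow> cmod (of_real r * cis x) = r"
  by (simp add: norm_mult)

lemma circle_mean_integrable:
  assumes "F holomorphic_on unit_disk" "0 \<le> r" "r < 1"
  shows "(\<lambda>t. (cmod (F (of_real r * cis (2 * pi * t))))\<^sup>2) integrable_on {0..1}"
proof (intro integrable_continuous_interval continuous_intros)
  show "continuous_on {0..1} (\<lambda>t. F (of_real r * cis (2 * pi * t)))"
    by (rule continuous_on_compose2[OF holomorphic_on_imp_continuous_on[OF assms(1)]])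
       (use assms in \<open>auto intro!: continuous_intros simp: circle_point\<close>)
qed

text \<open>
  Follows from the identity for the Taylor polynomials: on a circle inside the disk they are bounded
  by the sum of the absolutely convergent series, so their means converge.
\<close>
lemma parseval_circle:
  assumes F: "F holomorphic_on unit_disk" and r: "0 \<le> r" "r < 1"
  shows "(\<lambda>n. (cmod (taylor_coeff F n))\<^sup>2 * r ^ (2 * n)) sums circle_mean r F"
proof -
  let ?c = "taylor_coeff F" and ?z = "\<lambda>t. of_real r * cis (2 * pi * t)"
  let ?P = "\<lambda>N z. \<Sum>n<N. ?c n * z ^ n"
  \<comment> \<open>Convergence at the larger radius \<open>s\<close> gives absolute convergence at \<open>r\<close>.\<close>
  obtain s where s: "r < s" "s < 1" using r dense by blast
  have "summable (\<lambda>n. ?c n * of_real s ^ n)"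
    using taylor_coeff_sums[OF F, of "of_real s"] r s by (auto simp: sums_iff)
  then have "summable (\<lambda>n. cmod (?c n * of_real r ^ n))"
    by (rule powser_insidea) (use r s in auto)
  then have sm: "summable (\<lambda>n. cmod (?c n) * r ^ n)"
    using r by (simp add: norm_mult norm_power)
  define B where "B = (\<Sum>n. cmod (?c n) * r ^ n)"
  have bnd: "cmod (?P N (?z t)) \<le> B" for N t
  proof -
    have "cmod (?P N (?z t)) \<le> (\<Sum>n<N. cmod (?c n) * r ^ n)"
      using r by (intro sum_norm_le) (simp add: norm_mult norm_power)
    also have "\<dots> \<le> B"
      unfolding B_def using sm r by (intro sum_le_suminf) auto
    finally show ?thesis .
  qed
  have "(\<lambda>N. integral {0..1} (\<lambda>t. (cmod (?P N (?z t)))\<^sup>2)) \<longlonglongrightarrow>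
        integral {0..1} (\<lambda>t. (cmod (F (?z t)))\<^sup>2)"
  proof (rule dominated_convergence)
    show "(\<lambda>t. (cmod (?P N (?z t)))\<^sup>2) integrable_on {0..1}" for N
      by (rule circle_mean_integrable) (use r in \<open>auto intro!: holomorphic_intros\<close>)
    show "(\<lambda>t::real. B\<^sup>2) integrable_on {0..1}" by (rule integrable_const_ivl)
    show "norm ((cmod (?P N (?z t)))\<^sup>2) \<le> B\<^sup>2" for N t
      using power_mono[OF bnd[of t N] norm_ge_zero, of 2] by simp
    show "(\<lambda>N. (cmod (?P N (?z t)))\<^sup>2) \<longlonglongrightarrow> (cmod (F (?z t)))\<^sup>2" for t
      using taylor_coeff_sums[OF F, of "?z t"] r
      by (intro tendsto_intros) (simp add: sums_def norm_mult)
  qed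
  then have "(\<lambda>N. circle_mean r (?P N)) \<longlonglongrightarrow> circle_mean r F"
    by (simp only: circle_mean_def)
  then show ?thesis
    by (simp only: circle_mean_polynomial sums_def)
qed

lemma taylor_coeff_eqI:
  assumes "\<And>z. cmod z < 1 \<Longrightarrow> (\<lambda>n. c n * z ^ n) sums F z"
  shows "taylor_coeff F n = c n"
proof -
  have "eventually (\<lambda>z::complex. z \<in> ball 0 1) (nhds 0)"
    by (intro eventually_nhds_in_open) auto
  then have "F has_fps_expansion Abs_fps c"
    by (intro has_fps_expansionI) (auto elim!: eventually_mono intro!: assms)
  then show ?thesis
    by (simp add: taylor_coeff_def fps_expansion_eqI)
qed

section \<open>The Hardy norm\<close>

lemma hardy_norm_squared:
  assumes "F \<in> hardy_space" shows "(hardy_norm F)\<^sup>2 = (\<Sum>n. (cmod (taylor_coeff F n))\<^sup>2)"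
  using assms by (auto simp: hardy_norm_def hardy_space_def suminf_nonneg)

lemma hardy_norm_nonneg: "F \<in> hardy_space \<Longrightarrow> 0 \<le> hardy_norm F"
  by (auto simp: hardy_norm_def hardy_space_def suminf_nonneg)

lemma circle_mean_le_hardy_norm:
  assumes F: "F \<in> hardy_space" and r: "0 \<le> r" "r < 1"
  shows "circle_mean r F \<le> (hardy_norm F)\<^sup>2"
proof -
  have hol: "F holomorphic_on unit_disk" and sm: "summable (\<lambda>n. (cmod (taylor_coeff F n))\<^sup>2)"
    using F by (auto simp: hardy_space_def)
  have "r ^ (2 * n) \<le> 1" for n
    using r by (simp add: power_le_one)
  then show ?thesis
    unfolding hardy_norm_squared[OF F]
    by (intro sums_le[OF _ parseval_circle[OF hol r] summable_sums[OF sm]])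
       (simp add: mult_left_le)
qed

text \<open>
  A bound on the means over all circles inside the disk passes to each partial sum of the squared
  coefficients as the radius tends to \<open>1\<close>.
\<close>
lemma coefficients_bounded_by_circle_means:
  assumes hol: "F holomorphic_on unit_disk"
    and bnd: "\<And>r. 0 < r \<Longrightarrow> r < 1 \<Longrightarrow> circle_mean r F \<le> B"
  shows "summable (\<lambda>n. (cmod (taylor_coeff F n))\<^sup>2)"
    and "(\<Sum>n. (cmod (taylor_coeff F n))\<^sup>2) \<le> B"
proof -
  have fin: "(\<Sum>n<N. (cmod (taylor_coeff F n))\<^sup>2) \<le> B" for N
  proof (rule tendsto_upperbound)
    let ?s = "\<lambda>r::real. \<Sum>n<N. (cmod (taylor_coeff F n))\<^sup>2 * r ^ (2 * n)"
    have "(?s \<longlongrightarrow> ?s 1) (at_left 1)"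
      by (intro tendsto_intros)
    then show "(?s \<longlongrightarrow> (\<Sum>n<N. (cmod (taylor_coeff F n))\<^sup>2)) (at_left 1)" by simp
    have "?s r \<le> B" if "0 < r" "r < 1" for r
    proof -
      have "?s r \<le> circle_mean r F"
        using parseval_circle[OF hol, of r] that
              sum_le_suminf[of "\<lambda>n. (cmod (taylor_coeff F n))\<^sup>2 * r ^ (2 * n)" "{..<N}"]
        by (simp add: sums_iff)
      with bnd[OF that] show ?thesis by simp
    qed
    then show "\<forall>\<^sub>F r in at_left 1. ?s r \<le> B"
      by (intro eventually_at_leftI[of 0]) auto
  qed simp
  show "summable (\<lambda>n. (cmod (taylor_coeff F n))\<^sup>2)"
    using fin by (intro summableI_nonneg_bounded) auto
  then show "(\<Sum>n. (cmod (taylor_coeff F n))\<^sup>2) \<le> B"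
    using fin by (intro suminf_le_const) auto
qed

text \<open>
  Circle means, unlike coefficients, compare pointwise. This is the way by which inequalities on the
  disk become inequalities between norms.
\<close>
lemma hardy_dominated:
  assumes hol: "F holomorphic_on unit_disk" and zero: "\<And>z. z \<notin> unit_disk \<Longrightarrow> F z = 0"
    and G: "G \<in> hardy_space" and le: "\<And>z. cmod z < 1 \<Longrightarrow> cmod (F z) \<le> cmod (G z)"
  shows "F \<in> hardy_space" and "hardy_norm F \<le> hardy_norm G"
proof -
  have bnd: "circle_mean r F \<le> (hardy_norm G)\<^sup>2" if "0 < r" "r < 1" for r
  proof -
    have "G holomorphic_on unit_disk" using G by (simp add: hardy_space_def)
    then have "circle_mean r F \<le> circle_mean r G"
      unfolding circle_mean_def using that
      by (intro integral_le circle_mean_integrable hol power_mono le) (auto simp: norm_mult)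
    also have "\<dots> \<le> (hardy_norm G)\<^sup>2"
      using that by (intro circle_mean_le_hardy_norm G) auto
    finally show ?thesis .
  qed
  note * = coefficients_bounded_by_circle_means[OF hol bnd]
  show "F \<in> hardy_space"
    using * hol zero by (auto simp: hardy_space_def)
  show "hardy_norm F \<le> hardy_norm G"
    using real_le_lsqrt[OF hardy_norm_nonneg[OF G] *(2)] by (simp add: hardy_norm_def)
qed

section \<open>Polynomials and point evaluations\<close>

definition disk_polynomial :: "nat \<Rightarrow> (nat \<Rightarrow> complex) \<Rightarrow> complex \<Rightarrow> complex" where
  "disk_polynomial N c z = (if z \<in> unit_disk then \<Sum>n<N. c n * z ^ n else 0)"

lemma taylor_coeff_disk_polynomial:
  "taylor_coeff (disk_polynomial N c) n = (if n < N then c n else 0)"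
proof (rule taylor_coeff_eqI)
  fix z :: complex assume "cmod z < 1"
  then show "(\<lambda>n. (if n < N then c n else 0) * z ^ n) sums disk_polynomial N c z"
    using sums_If_finite_set[of "{..<N}" "\<lambda>n. c n * z ^ n"]
    by (simp add: disk_polynomial_def if_distrib[of "\<lambda>x. x * _"] cong: if_cong)
qed

lemma holomorphic_on_disk_polynomial: "disk_polynomial N c holomorphic_on unit_disk"
  by (rule holomorphic_transform[of "\<lambda>z. \<Sum>n<N. c n * z ^ n"])
     (auto intro!: holomorphic_intros simp: disk_polynomial_def)

lemma disk_polynomial_hardy: "disk_polynomial N c \<in> hardy_space"
  and hardy_norm_disk_polynomial: "(hardy_norm (disk_polynomial N c))\<^sup>2 = (\<Sum>n<N. (cmod (c n))\<^sup>2)"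
proof -
  have "(\<lambda>n. (cmod (taylor_coeff (disk_polynomial N c) n))\<^sup>2) sums (\<Sum>n<N. (cmod (c n))\<^sup>2)"
    using sums_If_finite_set[of "{..<N}" "\<lambda>n. (cmod (c n))\<^sup>2"]
    by (simp add: taylor_coeff_disk_polynomial if_distrib[of "\<lambda>x. (cmod x)\<^sup>2"] cong: if_cong)
  moreover from this show *: "disk_polynomial N c \<in> hardy_space"
    using holomorphic_on_disk_polynomial
    by (auto simp: hardy_space_def sums_iff disk_polynomial_def)
  ultimately show "(hardy_norm (disk_polynomial N c))\<^sup>2 = (\<Sum>n<N. (cmod (c n))\<^sup>2)"
    by (simp add: hardy_norm_squared sums_iff)
qed

lemma disk_polynomials_dense:
  assumes h: "h \<in> hardy_space" and "\<epsilon> > 0"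
  obtains N c where "hardy_norm (h - disk_polynomial N c) < \<epsilon>"
proof -
  let ?c = "taylor_coeff h"
  have sm: "summable (\<lambda>n. (cmod (?c n))\<^sup>2)" and hol: "h holomorphic_on unit_disk"
    using h by (auto simp: hardy_space_def)
  obtain N where N: "norm (\<Sum>i. (cmod (?c (i + N)))\<^sup>2) < \<epsilon>\<^sup>2"
    using suminf_exist_split[OF _ sm, of "\<epsilon>\<^sup>2"] \<open>\<epsilon> > 0\<close> by auto
  let ?q = "h - disk_polynomial N ?c"
  have coeff: "taylor_coeff ?q n = (if n < N then 0 else ?c n)" for n
    by (simp add: taylor_coeff_diff[OF hol holomorphic_on_disk_polynomial]
          taylor_coeff_disk_polynomial)
  have q: "?q \<in> hardy_space"
    by (intro hardy_space_diff h disk_polynomial_hardy)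
  have "(hardy_norm ?q)\<^sup>2 = (\<Sum>n. (cmod (taylor_coeff ?q n))\<^sup>2)"
    by (rule hardy_norm_squared[OF q])
  also have "\<dots> = (\<Sum>i. (cmod (taylor_coeff ?q (i + N)))\<^sup>2) + (\<Sum>i<N. (cmod (taylor_coeff ?q i))\<^sup>2)"
    using q by (intro suminf_split_initial_segment) (auto simp: hardy_space_def)
  also have "\<dots> < \<epsilon>\<^sup>2"
    using N by (simp add: coeff)
  finally have "hardy_norm ?q < \<epsilon>"
    using \<open>\<epsilon> > 0\<close> power_less_imp_less_base[of "hardy_norm ?q" 2 \<epsilon>] by linarith
  with that show thesis .
qed

lemma hardy_reverse_triangle:
  assumes "F \<in> hardy_space" "G \<in> hardy_space"
  shows "hardy_norm (F - G) \<ge> hardy_norm F - hardy_norm G"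
  using l2_triangle(2)[of "taylor_coeff (F - G)" "taylor_coeff G"] hardy_space_diff[OF assms] assms
  by (simp add: hardy_norm_def hardy_space_def taylor_coeff_diff)

text \<open>
  The crude estimate of every coefficient by the norm and a geometric series suffice: all that matters
  is a finite constant for each point.
\<close>
lemma hardy_eval_bound:
  assumes h: "h \<in> hardy_space" and z: "cmod z < 1"
  shows "cmod (h z) \<le> hardy_norm h / (1 - cmod z)"
proof -
  have hol: "h holomorphic_on unit_disk" and sm: "summable (\<lambda>n. (cmod (taylor_coeff h n))\<^sup>2)"
    using h by (auto simp: hardy_space_def)
  have c: "cmod (taylor_coeff h n) \<le> hardy_norm h" for n
  proof -
    have "(cmod (taylor_coeff h n))\<^sup>2 \<le> (hardy_norm h)\<^sup>2"
      unfolding hardy_norm_squared[OF h] using sum_le_suminf[OF sm, of "{n}"] by simp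
    then show ?thesis
      using hardy_norm_nonneg[OF h] by (rule power2_le_imp_le)
  qed
  have g: "(\<lambda>n. hardy_norm h * cmod z ^ n) sums (hardy_norm h * (1 / (1 - cmod z)))"
    using z by (intro sums_mult geometric_sums) auto
  have "norm (\<Sum>n. taylor_coeff h n * z ^ n) \<le> (\<Sum>n. hardy_norm h * cmod z ^ n)"
    by (intro norm_suminf_le sums_summable[OF g])
       (auto simp: norm_mult norm_power intro!: mult_right_mono c)
  then show ?thesis
    using taylor_coeff_sums[OF hol z] g by (simp add: sums_iff)
qed

section \<open>Linear structure and closures\<close>

lemma hardy_scale:
  assumes f: "f \<in> hardy_space"
  shows "(\<lambda>z. c * f z) \<in> hardy_space" and "hardy_norm (\<lambda>z. c * f z) = cmod c * hardy_norm f"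
proof -
  have hol: "f holomorphic_on unit_disk" and sm: "summable (\<lambda>n. (cmod (taylor_coeff f n))\<^sup>2)"
    using f by (auto simp: hardy_space_def)
  have coeff: "taylor_coeff (\<lambda>z. c * f z) n = c * taylor_coeff f n" for n
    by (rule taylor_coeff_eqI) (use sums_mult[OF taylor_coeff_sums[OF hol]] in \<open>simp add: mult.assoc\<close>)
  show "(\<lambda>z. c * f z) \<in> hardy_space"
    using f by (auto simp: hardy_space_def coeff norm_mult power_mult_distrib
                     intro!: holomorphic_intros summable_mult)
  show "hardy_norm (\<lambda>z. c * f z) = cmod c * hardy_norm f"
    by (simp add: hardy_norm_def coeff norm_mult power_mult_distrib suminf_mult[OF sm] real_sqrt_mult)
qed

lemma hardy_add:
  assumes f: "f \<in> hardy_space" and g: "g \<in> hardy_space"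
  shows "f + g \<in> hardy_space" and "hardy_norm (f + g) \<le> hardy_norm f + hardy_norm g"
proof -
  have g': "- g \<in> hardy_space" and n: "hardy_norm (- g) = hardy_norm g"
    using hardy_scale[OF g, of "-1"] by (simp_all add: fun_Compl_def)
  show s: "f + g \<in> hardy_space"
    using hardy_space_diff[OF f g'] by simp
  show "hardy_norm (f + g) \<le> hardy_norm f + hardy_norm g"
    using hardy_reverse_triangle[OF s g] by simp
qed

lemma subspace_hardy_space: "cfun.subspace hardy_space"
proof -
  have "0 \<in> hardy_space"
  proof -
    have "0 = disk_polynomial 0 0" by (simp add: fun_eq_iff disk_polynomial_def)
    then show ?thesis by (metis disk_polynomial_hardy)
  qed
  then show ?thesis
    by (auto simp: cfun.subspace_def hardy_add hardy_scale)
qed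

lemma hardy_closure_iff:
  assumes "S \<subseteq> hardy_space"
  shows "x \<in> hardy.mtopology closure_of S \<longleftrightarrow>
    x \<in> hardy_space \<and> (\<forall>r>0. \<exists>y\<in>S. hardy_norm (x - y) < r)"
  using assms by (fastforce simp: hardy.metric_closure_of hardy_dist_def subset_iff)

lemma subspace_hardy_closure:
  assumes S: "S \<subseteq> hardy_space" and sub: "cfun.subspace S"
  shows "cfun.subspace (hardy.mtopology closure_of S)"
proof (rule cfun.subspaceI)
  show "0 \<in> hardy.mtopology closure_of S"
    using closure_of_subset[of S hardy.mtopology] S cfun.subspace_0[OF sub] by auto
next
  fix x y assume xy: "x \<in> hardy.mtopology closure_of S" "y \<in> hardy.mtopology closure_of S"
  then have H: "x \<in> hardy_space" "y \<in> hardy_space"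
    by (auto simp: hardy_closure_iff[OF S])
  have "\<exists>w\<in>S. hardy_norm (x + y - w) < r" if "r > 0" for r
  proof -
    obtain u v where uv: "u \<in> S" "v \<in> S" "hardy_norm (x - u) < r / 2" "hardy_norm (y - v) < r / 2"
      using xy \<open>r > 0\<close> unfolding hardy_closure_iff[OF S] by (meson half_gt_zero)
    have "x - u \<in> hardy_space" "y - v \<in> hardy_space"
      using H uv S by (auto intro: hardy_space_diff)
    then have "hardy_norm ((x - u) + (y - v)) \<le> hardy_norm (x - u) + hardy_norm (y - v)"
      by (rule hardy_add(2))
    moreover have "(x - u) + (y - v) = x + y - (u + v)" by (rule add_diff_add[symmetric])
    ultimately have "hardy_norm (x + y - (u + v)) \<le> hardy_norm (x - u) + hardy_norm (y - v)"
      by (simp only:)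
    moreover have "u + v \<in> S" using uv sub by (simp add: cfun.subspace_add)
    ultimately show ?thesis using uv by (intro bexI[of _ "u + v"]) auto
  qed
  then show "x + y \<in> hardy.mtopology closure_of S"
    using H hardy_add by (simp add: hardy_closure_iff[OF S])
next
  fix c x assume x: "x \<in> hardy.mtopology closure_of S"
  then have H: "x \<in> hardy_space"
    by (auto simp: hardy_closure_iff[OF S])
  have "\<exists>w\<in>S. hardy_norm ((\<lambda>z. c * x z) - w) < r" if "r > 0" for r
  proof -
    have "0 < r / (cmod c + 1)" using that by (simp add: add_nonneg_pos)
    then obtain u where u: "u \<in> S" "hardy_norm (x - u) < r / (cmod c + 1)"
      using x unfolding hardy_closure_iff[OF S] by blast
    have xu: "x - u \<in> hardy_space" using H u S by (auto intro: hardy_space_diff)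
    have "(\<lambda>z. c * x z) - (\<lambda>z. c * u z) = (\<lambda>z. c * (x - u) z)"
      by (simp add: fun_eq_iff algebra_simps)
    then have "hardy_norm ((\<lambda>z. c * x z) - (\<lambda>z. c * u z)) = cmod c * hardy_norm (x - u)"
      using hardy_scale(2)[OF xu] by simp
    also have "\<dots> \<le> (cmod c + 1) * hardy_norm (x - u)"
      using hardy_norm_nonneg[OF xu] by (simp add: mult_right_mono)
    also have "\<dots> < r"
      using u(2) by (simp add: pos_less_divide_eq add_nonneg_pos mult.commute)
    finally show ?thesis
      using cfun.subspace_scale[OF sub u(1)] by blast
  qed
  then show "(\<lambda>z. c * x z) \<in> hardy.mtopology closure_of S"
    using hardy_scale(1)[OF H] by (simp add: hardy_closure_iff[OF S])
qed

section \<open>Multiplication by the singular inner function\<close>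

definition singular_inner :: "real \<Rightarrow> complex \<Rightarrow> complex" where
  "singular_inner b z = exp (of_real b * ((z + 1) / (z - 1)))"

text \<open>
  The exponent is minus \<open>b\<close> times the Poisson kernel at the boundary point \<open>1\<close>: it is positive inside
  the disk, so that the modulus decays as \<open>b\<close> grows, and it is zero on the circle, so that the function
  is inner. At the point \<open>1\<close> itself the convention on division by zero gives modulus \<open>1\<close>.
\<close>
lemma norm_singular_inner:
  "cmod (singular_inner b z) = exp (- b * ((1 - (cmod z)\<^sup>2) / (cmod (z - 1))\<^sup>2))"
proof -
  have "Re ((z + 1) / (z - 1)) = - ((1 - (cmod z)\<^sup>2) / (cmod (z - 1))\<^sup>2)"
    by (simp add: Re_divide minus_divide_left cmod_power2)
       (simp add: power2_eq_square algebra_simps flip: add_divide_distrib diff_divide_distrib)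
  then have "Re (of_real b * ((z + 1) / (z - 1))) = - b * ((1 - (cmod z)\<^sup>2) / (cmod (z - 1))\<^sup>2)"
    by (simp only: Re_complex_of_real Im_complex_of_real times_complex.sel)
  then show ?thesis by (simp only: singular_inner_def norm_exp_eq_Re)
qed

lemma norm_singular_inner_le_1: "b \<ge> 0 \<Longrightarrow> cmod z < 1 \<Longrightarrow> cmod (singular_inner b z) \<le> 1"
  by (simp add: norm_singular_inner divide_nonneg_nonneg power_le_one)

lemma norm_singular_inner_circle: "cmod z = 1 \<Longrightarrow> cmod (singular_inner b z) = 1"
  by (simp add: norm_singular_inner)

lemma holomorphic_on_singular_inner: "singular_inner b holomorphic_on unit_disk"
  unfolding singular_inner_def by (intro holomorphic_intros) auto

abbreviation singular_mult :: "real \<Rightarrow> (complex \<Rightarrow> complex) \<Rightarrow> complex \<Rightarrow> complex" where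
  "singular_mult b h \<equiv> (\<lambda>z. singular_inner b z * h z)"

lemma singular_mult_hardy:
  assumes b: "b \<ge> 0" and h: "h \<in> hardy_space"
  shows "singular_mult b h \<in> hardy_space" and "hardy_norm (singular_mult b h) \<le> hardy_norm h"
proof -
  have *: "singular_mult b h holomorphic_on unit_disk"
    using h by (intro holomorphic_intros holomorphic_on_singular_inner) (simp add: hardy_space_def)
  have "cmod (singular_mult b h z) \<le> cmod (h z)" if "cmod z < 1" for z
    using norm_singular_inner_le_1[OF b that] by (simp add: norm_mult mult_left_le_one_le)
  note hardy_dominated[OF * _ h this]
  then show "singular_mult b h \<in> hardy_space" "hardy_norm (singular_mult b h) \<le> hardy_norm h"
    using h by (auto simp: hardy_space_def)
qed

text \<open>
  As the radius increases to \<open>1\<close>, the means of the product converge to the mean of the polynomial over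
  the unit circle, because the singular inner function is bounded by \<open>1\<close> and has unimodular boundary
  values away from the point \<open>1\<close>.
\<close>
lemma hardy_norm_singular_mult_polynomial:
  assumes b: "b \<ge> 0"
  shows "hardy_norm (disk_polynomial N c) \<le> hardy_norm (singular_mult b (disk_polynomial N c))"
proof -
  let ?p = "disk_polynomial N c" and ?P = "\<lambda>z. \<Sum>n<N. c n * z ^ n"
  let ?F = "singular_mult b ?p"
  define r where "r k = real k / real (Suc k)" for k
  let ?e = "\<lambda>t. cis (2 * pi * t)"
  have p: "?p \<in> hardy_space" by (rule disk_polynomial_hardy)
  have F: "?F \<in> hardy_space" by (rule singular_mult_hardy[OF b p])
  then have hol: "?F holomorphic_on unit_disk" by (simp add: hardy_space_def)
  have r: "0 \<le> r k" "r k < 1" for k by (auto simp: r_def)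
  have rlim: "r \<longlonglongrightarrow> 1"
    unfolding r_def by (rule LIMSEQ_n_over_Suc_n)
  have Fr: "?F (of_real (r k) * ?e t) = singular_inner b (of_real (r k) * ?e t) * ?P (of_real (r k) * ?e t)" for k t
    using r[of k] unfolding disk_polynomial_def mem_ball_0
    by (simp only: circle_point if_True)
  define B where "B = (\<Sum>n<N. cmod (c n))"
  have bnd: "cmod (?F (of_real (r k) * ?e t)) \<le> B" for k t
  proof -
    have "cmod (?P (of_real (r k) * ?e t)) \<le> B"
      unfolding B_def using r[of k]
      by (intro sum_norm_le) (simp add: norm_mult norm_power mult_left_le power_le_one)
    moreover have "cmod (singular_inner b (of_real (r k) * ?e t)) \<le> 1"
      using r[of k] by (intro norm_singular_inner_le_1 b) (simp add: norm_mult)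
    moreover have "0 \<le> B" by (simp add: B_def sum_nonneg)
    ultimately show ?thesis
      unfolding Fr norm_mult using mult_mono[of _ 1 _ B] by fastforce
  qed
  \<comment> \<open>At the endpoints of the interval the circle is approached along the radius to \<open>1\<close>, where
      the singular inner function may tend to \<open>0\<close>. The open interval leaves out this radius.\<close>
  have "(\<lambda>k. integral {0<..<1} (\<lambda>t. (cmod (?F (of_real (r k) * ?e t)))\<^sup>2))
          \<longlonglongrightarrow> integral {0<..<1} (\<lambda>t. (cmod (?P (of_real 1 * ?e t)))\<^sup>2)"
  proof (rule dominated_convergence)
    show "(\<lambda>t. (cmod (?F (of_real (r k) * ?e t)))\<^sup>2) integrable_on {0<..<1}" for k
      using circle_mean_integrable[OF hol r] by (simp only: integrable_on_open_interval_real)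
    show "(\<lambda>t::real. B\<^sup>2) integrable_on {0<..<1}"
      by (simp add: integrable_on_open_interval_real integrable_const_ivl)
    show "norm ((cmod (?F (of_real (r k) * ?e t)))\<^sup>2) \<le> B\<^sup>2" for k t
      using power_mono[OF bnd[of k t] norm_ge_zero, of 2] by simp
    show "(\<lambda>k. (cmod (?F (of_real (r k) * ?e t)))\<^sup>2) \<longlonglongrightarrow> (cmod (?P (of_real 1 * ?e t)))\<^sup>2"
      if "t \<in> {0<..<1}" for t
    proof -
      have "?e t \<noteq> 1"
      proof
        assume "?e t = 1"
        then have "cos (2 * pi * t) = 1" by (simp add: complex_eq_iff)
        then obtain n :: int where "2 * pi * t = of_int n * 2 * pi"
          by (auto simp: cos_one_2pi_int)
        then have "t = of_int n" by simp
        then show False using that by auto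
      qed
      moreover have lim: "(\<lambda>k. of_real (r k) * ?e t) \<longlonglongrightarrow> of_real 1 * ?e t"
        by (intro tendsto_intros rlim)
      ultimately have "(\<lambda>k. singular_inner b (of_real (r k) * ?e t)) \<longlonglongrightarrow> singular_inner b (of_real 1 * ?e t)"
        unfolding singular_inner_def by (intro tendsto_exp tendsto_mult tendsto_divide tendsto_add tendsto_diff tendsto_const tendsto_of_real rlim) auto
      then have "(\<lambda>k. (cmod (?F (of_real (r k) * ?e t)))\<^sup>2)
          \<longlonglongrightarrow> (cmod (singular_inner b (of_real 1 * ?e t) * ?P (of_real 1 * ?e t)))\<^sup>2"
        unfolding Fr by (intro tendsto_intros lim)
      then show ?thesis by (simp add: norm_mult norm_singular_inner_circle)
    qed
  qed
  then have "(\<lambda>k. circle_mean (r k) ?F) \<longlonglongrightarrow> circle_mean 1 ?P"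
    unfolding circle_mean_def by (simp only: integral_open_interval_real)
  then have "circle_mean 1 ?P \<le> (hardy_norm ?F)\<^sup>2"
    by (rule LIMSEQ_le_const2) (use circle_mean_le_hardy_norm[OF F r] in blast)
  then have "(hardy_norm ?p)\<^sup>2 \<le> (hardy_norm ?F)\<^sup>2"
    by (simp add: circle_mean_polynomial hardy_norm_disk_polynomial)
  then show ?thesis
    using hardy_norm_nonneg[OF F] by (rule power2_le_imp_le)
qed

text \<open>
  Together with \<open>singular_mult_hardy\<close> this makes the multiplication isometric. The case of polynomials
  extends by density, since multiplication does not increase the norm of the remainder.
\<close>
lemma hardy_norm_singular_mult:
  assumes b: "b \<ge> 0" and h: "h \<in> hardy_space"
  shows "hardy_norm h \<le> hardy_norm (singular_mult b h)"
proof (rule field_le_epsilon)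
  fix \<epsilon> :: real assume "\<epsilon> > 0"
  then obtain N c where less: "hardy_norm (h - disk_polynomial N c) < \<epsilon> / 2"
    using disk_polynomials_dense[OF h, of "\<epsilon> / 2"] by auto
  let ?p = "disk_polynomial N c"
  have p: "?p \<in> hardy_space" by (rule disk_polynomial_hardy)
  have q: "?p - h \<in> hardy_space" using p h by (rule hardy_space_diff)
  note H = singular_mult_hardy[OF b]
  have "singular_mult b ?p - singular_mult b h = singular_mult b (?p - h)"
    by (simp add: fun_eq_iff algebra_simps)
  then have "hardy_norm (singular_mult b ?p) - hardy_norm (singular_mult b h) \<le> hardy_norm (?p - h)"
    using hardy_reverse_triangle[OF H(1)[OF p] H(1)[OF h]] H(2)[OF q] by simp
  moreover have "hardy_norm h - hardy_norm ?p \<le> hardy_norm (h - ?p)"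
    by (rule hardy_reverse_triangle[OF h p])
  moreover have "hardy_norm (?p - h) = hardy_norm (h - ?p)"
    using hardy.commute[of ?p h] p h by (simp add: hardy_dist_def)
  moreover have "hardy_norm ?p \<le> hardy_norm (singular_mult b ?p)"
    by (rule hardy_norm_singular_mult_polynomial[OF b])
  ultimately show "hardy_norm h \<le> hardy_norm (singular_mult b h) + \<epsilon>"
    using less by linarith
qed

section \<open>The composition operator is bounded and injective\<close>

text \<open>
  The weights \<open>(n + k choose k) * a ^ k * (1 - a) ^ n\<close> below are the entries of the matrix of the
  composition operator in the monomial basis, with \<open>k\<close> the row and \<open>n + k\<close> the column. Boundedness
  is Schur's test for this nonnegative matrix: its rows sum to at most \<open>1 / a\<close>, by the negative binomial
  series, and its columns sum to \<open>1\<close>, by the binomial theorem.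
\<close>

lemma negative_binomial_sum_le:
  fixes a :: real
  assumes a: "0 < a" "a < 1"
  shows "(\<Sum>n<N. real (n + k choose k) * (1 - a) ^ n) * a ^ Suc k \<le> 1"
proof (induction k)
  case 0
  have "a * (\<Sum>n<N. (1 - a) ^ n) = 1 - (1 - a) ^ N"
    using one_diff_power_eq[of "1 - a" N] by simp
  then show ?case using a by (simp add: mult.commute)
next
  case (Suc k)
  \<comment> \<open>Summation of Pascal's rule. The subtracted term is what the truncation at \<open>N\<close> leaves over.\<close>
  have "a * (\<Sum>n<N. real (n + Suc k choose Suc k) * (1 - a) ^ n) =
        (\<Sum>n<N. real (n + k choose k) * (1 - a) ^ n) - (1 - a) ^ N * real (N + k choose Suc k)"
    by (induction N) (simp_all add: algebra_simps)
  also have "\<dots> \<le> (\<Sum>n<N. real (n + k choose k) * (1 - a) ^ n)"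
    using a by simp
  finally have "(a * (\<Sum>n<N. real (n + Suc k choose Suc k) * (1 - a) ^ n)) * a ^ Suc k \<le>
        (\<Sum>n<N. real (n + k choose k) * (1 - a) ^ n) * a ^ Suc k"
    using a by (intro mult_right_mono) auto
  then show ?case
    using Suc.IH by (simp add: mult_ac)
qed

text \<open>
  The rectangle of indices is enlarged to full columns, each of which has weights that sum to
  \<open>(a + (1 - a)) ^ m\<close>.
\<close>
lemma binomial_double_sum_le:
  fixes a :: real and g :: "nat \<Rightarrow> real"
  assumes a: "0 < a" "a < 1" and g: "\<And>n. 0 \<le> g n"
  shows "(\<Sum>k<K. \<Sum>n<N. real (n + k choose k) * a ^ k * (1 - a) ^ n * g (n + k)) \<le> (\<Sum>m<K + N. g m)"
proof -
  let ?h = "\<lambda>(m, k). real (m choose k) * a ^ k * (1 - a) ^ (m - k) * g m"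
  let ?i = "\<lambda>(k :: nat, n). (n + k, k)"
  have "(\<Sum>k<K. \<Sum>n<N. real (n + k choose k) * a ^ k * (1 - a) ^ n * g (n + k)) =
        sum (?h \<circ> ?i) ({..<K} \<times> {..<N})"
    by (simp add: sum.cartesian_product case_prod_beta o_def)
  also have "\<dots> = sum ?h (?i ` ({..<K} \<times> {..<N}))"
    by (rule sum.reindex[symmetric]) (auto simp: inj_on_def)
  also have "\<dots> \<le> sum ?h (SIGMA m:{..<K + N}. {..m})"
    using a by (intro sum_mono2) (auto intro!: mult_nonneg_nonneg g)
  also have "\<dots> = (\<Sum>m<K + N. \<Sum>k\<le>m. real (m choose k) * a ^ k * (1 - a) ^ (m - k) * g m)"
    by (rule sum.Sigma[symmetric]) auto
  also have "\<dots> = (\<Sum>m<K + N. (a + (1 - a)) ^ m * g m)"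
    unfolding binomial_ring by (simp add: sum_distrib_right)
  finally show ?thesis by simp
qed

lemma affine_symbol_in_disk:
  assumes a: "0 < a" "a < 1" and z: "cmod z < 1"
  shows "cmod (affine_symbol a z) < 1"
proof -
  have "cmod (affine_symbol a z) \<le> cmod (of_real a * z) + cmod (of_real (1 - a))"
    unfolding affine_symbol_def using norm_triangle_ineq[of "of_real a * z" "of_real (1 - a)"] by simp
  also have "\<dots> = a * cmod z + (1 - a)"
    using a unfolding norm_mult norm_of_real by simp
  also have "\<dots> < 1" using a z by simp
  finally show ?thesis .
qed

lemma holomorphic_comp_affine:
  assumes a: "0 < a" "a < 1" and f: "f holomorphic_on unit_disk"
  shows "(\<lambda>z. f (affine_symbol a z)) holomorphic_on unit_disk"
proof -
  have "affine_symbol a ` unit_disk \<subseteq> unit_disk"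
    using affine_symbol_in_disk[OF a] by auto
  moreover have "affine_symbol a holomorphic_on unit_disk"
    unfolding affine_symbol_def by (intro holomorphic_intros)
  ultimately show ?thesis
    using holomorphic_on_compose_gen[OF _ f] by (simp add: o_def)
qed

lemma holomorphic_comp_op:
  assumes "0 < a" "a < 1" and "f holomorphic_on unit_disk"
  shows "comp_op (affine_symbol a) f holomorphic_on unit_disk"
  using holomorphic_comp_affine[OF assms]
  by (rule holomorphic_transform) (simp add: comp_op_def)

text \<open>
  By the chain rule the coefficient is \<open>a ^ k / fact k\<close> times the derivative of order \<open>k\<close> at
  \<open>1 - a\<close>, which is then expanded in the power series of that derivative at \<open>0\<close>.
\<close>
lemma taylor_coeff_comp_affine:
  assumes a: "0 < a" "a < 1" and f: "f holomorphic_on unit_disk"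
  shows "(\<lambda>n. of_real (real (n + k choose k) * a ^ k * (1 - a) ^ n) * taylor_coeff f (n + k))
           sums taylor_coeff (comp_op (affine_symbol a) f) k"
proof -
  have "(deriv ^^ k) (comp_op (affine_symbol a) f) 0 = (deriv ^^ k) (\<lambda>z. f (affine_symbol a z)) 0"
    by (rule higher_deriv_transform_within_open[where S = unit_disk])
       (use holomorphic_comp_op[OF a f] holomorphic_comp_affine[OF a f] in \<open>auto simp: comp_op_def\<close>)
  also have "\<dots> = of_real a ^ k * (deriv ^^ k) f (1 - of_real a)"
    unfolding affine_symbol_def
    using higher_deriv_compose_linear'[OF f, of unit_disk 0 "of_real a" "1 - of_real a" k]
          affine_symbol_in_disk[OF a]
    by (simp add: affine_symbol_def)
  finally have eq: "taylor_coeff (comp_op (affine_symbol a) f) k =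
      of_real a ^ k / fact k * (deriv ^^ k) f (1 - of_real a)"
    by (simp add: taylor_coeff_def fps_expansion_def)
  have "(\<lambda>n. (deriv ^^ n) ((deriv ^^ k) f) 0 / fact n * ((1 - of_real a) - 0) ^ n) sums
        (deriv ^^ k) f (1 - of_real a)"
  proof (rule holomorphic_power_series[where r = 1])
    have "cmod (1 - of_real a) = 1 - a"
      using a by (metis abs_of_nonneg diff_ge_0_iff_ge less_imp_le norm_of_real of_real_1 of_real_diff)
    then show "1 - of_real a \<in> unit_disk" using a by simp
  qed (intro holomorphic_higher_deriv f open_ball)
  then have "(\<lambda>n. of_real a ^ k / fact k * ((deriv ^^ n) ((deriv ^^ k) f) 0 / fact n * ((1 - of_real a) - 0) ^ n)) sums
        taylor_coeff (comp_op (affine_symbol a) f) k"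
    unfolding eq by (rule sums_mult)
  moreover have "of_real a ^ k / fact k * ((deriv ^^ n) ((deriv ^^ k) f) 0 / fact n * ((1 - of_real a) - 0) ^ n) =
      of_real (real (n + k choose k) * a ^ k * (1 - a) ^ n) * taylor_coeff f (n + k)" for n
  proof -
    have "complex_of_real (real (n + k choose k)) = fact (n + k) / (fact k * fact n)"
      using binomial_fact[of k "n + k", where 'a = complex] by simp
    moreover have "(deriv ^^ n) ((deriv ^^ k) f) 0 = fact (n + k) * taylor_coeff f (n + k)"
      by (simp add: taylor_coeff_def fps_expansion_def funpow_add)
    ultimately show ?thesis by simp
  qed
  ultimately show ?thesis by simp
qed

lemma comp_op_hardy:
  assumes a: "0 < a" "a < 1" and f: "f \<in> hardy_space"
  shows "comp_op (affine_symbol a) f \<in> hardy_space"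
    and "hardy_norm (comp_op (affine_symbol a) f) \<le> hardy_norm f / sqrt a"
proof -
  have hol: "f holomorphic_on unit_disk" and sm: "summable (\<lambda>n. (cmod (taylor_coeff f n))\<^sup>2)"
    using f by (auto simp: hardy_space_def)
  define w where "w k n = real (n + k choose k) * a ^ k * (1 - a) ^ n" for k n
  let ?c = "taylor_coeff f" and ?b = "taylor_coeff (comp_op (affine_symbol a) f)"
  have w: "0 \<le> w k n" for k n
    using a by (simp add: w_def)
  have row: "(\<Sum>n<N. w k n) \<le> 1 / a" for k N
    using negative_binomial_sum_le[OF a, of k N] a
    by (simp add: w_def field_simps sum_distrib_left)
  \<comment> \<open>Cauchy-Schwarz with each weight split into two square roots, so that one factor is a row sum.\<close>
  have part: "(cmod (\<Sum>n<N. of_real (w k n) * ?c (n + k)))\<^sup>2 \<le>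
      (1 / a) * (\<Sum>n<N. w k n * (cmod (?c (n + k)))\<^sup>2)" for k N
  proof -
    have "cmod (\<Sum>n<N. of_real (w k n) * ?c (n + k)) \<le>
          (\<Sum>n<N. sqrt (w k n) * (sqrt (w k n) * cmod (?c (n + k))))"
      using w by (intro sum_norm_le) (simp add: norm_mult flip: mult.assoc)
    then have "(cmod (\<Sum>n<N. of_real (w k n) * ?c (n + k)))\<^sup>2 \<le>
          (\<Sum>n<N. sqrt (w k n) * (sqrt (w k n) * cmod (?c (n + k))))\<^sup>2"
      by (intro power_mono) auto
    also have "\<dots> \<le> (\<Sum>n<N. (sqrt (w k n))\<^sup>2) * (\<Sum>n<N. (sqrt (w k n) * cmod (?c (n + k)))\<^sup>2)"
      by (rule Cauchy_Schwarz_ineq_sum)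
    also have "\<dots> = (\<Sum>n<N. w k n) * (\<Sum>n<N. w k n * (cmod (?c (n + k)))\<^sup>2)"
      using w by (simp add: power_mult_distrib)
    also have "\<dots> \<le> (1 / a) * (\<Sum>n<N. w k n * (cmod (?c (n + k)))\<^sup>2)"
      using w by (intro mult_right_mono row sum_nonneg) auto
    finally show ?thesis .
  qed
  have fin: "(\<Sum>k<K. (cmod (?b k))\<^sup>2) \<le> (1 / a) * (hardy_norm f)\<^sup>2" for K
  proof (rule LIMSEQ_le_const2)
    show "(\<lambda>N. \<Sum>k<K. (cmod (\<Sum>n<N. of_real (w k n) * ?c (n + k)))\<^sup>2) \<longlonglongrightarrow> (\<Sum>k<K. (cmod (?b k))\<^sup>2)"
      using taylor_coeff_comp_affine[OF a hol] unfolding sums_def w_def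
      by (intro tendsto_intros)
    have "(\<Sum>k<K. (cmod (\<Sum>n<N. of_real (w k n) * ?c (n + k)))\<^sup>2) \<le> (1 / a) * (hardy_norm f)\<^sup>2" for N
    proof -
      have "(\<Sum>k<K. (cmod (\<Sum>n<N. of_real (w k n) * ?c (n + k)))\<^sup>2) \<le>
            (1 / a) * (\<Sum>k<K. \<Sum>n<N. w k n * (cmod (?c (n + k)))\<^sup>2)"
        unfolding sum_distrib_left[of "1 / a" _ "{..<K}"] by (intro sum_mono part)
      also have "(\<Sum>k<K. \<Sum>n<N. w k n * (cmod (?c (n + k)))\<^sup>2) \<le> (\<Sum>m<K + N. (cmod (?c m))\<^sup>2)"
        unfolding w_def by (rule binomial_double_sum_le[OF a]) simp
      also have "\<dots> \<le> (hardy_norm f)\<^sup>2"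
        unfolding hardy_norm_squared[OF f] by (intro sum_le_suminf sm) auto
      finally show ?thesis using a by (simp add: divide_right_mono)
    qed
    then show "\<exists>M. \<forall>N\<ge>M. (\<Sum>k<K. (cmod (\<Sum>n<N. of_real (w k n) * ?c (n + k)))\<^sup>2) \<le> (1 / a) * (hardy_norm f)\<^sup>2"
      by blast
  qed
  have sb: "summable (\<lambda>k. (cmod (?b k))\<^sup>2)"
    using fin by (intro summableI_nonneg_bounded) auto
  then show "comp_op (affine_symbol a) f \<in> hardy_space"
    using holomorphic_comp_op[OF a hol] by (auto simp: hardy_space_def comp_op_def)
  have "(\<Sum>k. (cmod (?b k))\<^sup>2) \<le> (hardy_norm f / sqrt a)\<^sup>2"
    using suminf_le_const[OF sb fin] a by (simp add: power_divide)
  then show "hardy_norm (comp_op (affine_symbol a) f) \<le> hardy_norm f / sqrt a"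
    unfolding hardy_norm_def[of "comp_op _ _"]
    using a hardy_norm_nonneg[OF f] by (intro real_le_lsqrt) auto
qed

text \<open>
  The affine image of the disk is a nonempty open subset of the disk, so the identity theorem
  applies.
\<close>
lemma comp_op_affine_injective:
  assumes a: "0 < a" "a < 1" and f: "f \<in> hardy_space" and 0: "comp_op (affine_symbol a) f = 0"
  shows "f = 0"
proof
  fix z
  have hol: "f holomorphic_on unit_disk" using f by (simp add: hardy_space_def)
  show "f z = 0 z"
  proof (cases "z \<in> unit_disk")
    case True
    have "open (affine_symbol a ` unit_disk)"
    proof -
      have "affine_symbol a = (\<lambda>z. (1 - of_real a) + a *\<^sub>R z)"
        by (simp add: affine_symbol_def scaleR_conv_of_real fun_eq_iff)
      then show ?thesis
        using open_affinity[of unit_disk a "1 - of_real a"] a by simp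
    qed
    have "f z = (\<lambda>_. 0) z"
    proof (rule analytic_continuation_open[of "affine_symbol a ` unit_disk" unit_disk f "\<lambda>_. 0"])
      show "affine_symbol a ` unit_disk \<subseteq> unit_disk"
        using affine_symbol_in_disk[OF a] by auto
      show "f w = 0" if "w \<in> affine_symbol a ` unit_disk" for w
      proof -
        from that obtain v where "v \<in> unit_disk" "w = affine_symbol a v" by blast
        then show ?thesis using fun_cong[OF 0, of v] by (simp add: comp_op_def)
      qed
    qed (use True hol \<open>open (affine_symbol a ` unit_disk)\<close> in auto)
    then show ?thesis by simp
  qed (use f in \<open>auto simp: hardy_space_def\<close>)
qed

section \<open>Cyclic subspaces\<close>

lemma comp_op_add: "comp_op \<phi> (f + g) = comp_op \<phi> f + comp_op \<phi> g"
  and comp_op_diff: "comp_op \<phi> (f - g) = comp_op \<phi> f - comp_op \<phi> g"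
  and comp_op_scale: "comp_op \<phi> (\<lambda>z. c * f z) = (\<lambda>z. c * comp_op \<phi> f z)"
  and comp_op_zero: "comp_op \<phi> 0 = 0"
  by (auto simp: comp_op_def fun_eq_iff)

lemma invariant_subspace_closure:
  assumes a: "0 < a" "a < 1" and S: "S \<subseteq> hardy_space" and sub: "cfun.subspace S"
    and inv: "comp_op (affine_symbol a) ` S \<subseteq> S"
  shows "invariant_subspace (comp_op (affine_symbol a)) (hardy.mtopology closure_of S)"
proof -
  let ?C = "comp_op (affine_symbol a)"
  have "?C x \<in> hardy.mtopology closure_of S" if x: "x \<in> hardy.mtopology closure_of S" for x
  proof -
    have H: "x \<in> hardy_space" using x by (simp add: hardy_closure_iff[OF S])
    have "\<exists>w\<in>S. hardy_norm (?C x - w) < r" if "r > 0" for r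
    proof -
      have "0 < r * sqrt a" using that a by simp
      then obtain y where y: "y \<in> S" "hardy_norm (x - y) < r * sqrt a"
        using x unfolding hardy_closure_iff[OF S] by blast
      have "x - y \<in> hardy_space" using H y S by (auto intro: hardy_space_diff)
      then have "hardy_norm (?C x - ?C y) \<le> hardy_norm (x - y) / sqrt a"
        using comp_op_hardy(2)[OF a] by (simp flip: comp_op_diff)
      also have "\<dots> < r" using y(2) a by (simp add: pos_divide_less_eq)
      finally show ?thesis using inv y(1) by blast
    qed
    then show ?thesis
      using comp_op_hardy(1)[OF a H] by (simp add: hardy_closure_iff[OF S])
  qed
  moreover have "hardy.mtopology closure_of S \<subseteq> hardy_space"
    by (auto simp: hardy_closure_iff[OF S])
  ultimately show ?thesis
    unfolding invariant_subspace_def using subspace_hardy_closure[OF S sub] by auto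
qed

lemma comp_op_power_hardy:
  assumes a: "0 < a" "a < 1" and f: "f \<in> hardy_space"
  shows "(comp_op (affine_symbol a) ^^ n) f \<in> hardy_space"
  by (induction n) (simp_all add: f comp_op_hardy[OF a])

lemma cyclic_subspace_properties:
  assumes a: "0 < a" "a < 1" and f: "f \<in> hardy_space"
  defines "C \<equiv> comp_op (affine_symbol a)"
  shows "invariant_subspace C (cyclic_subspace C f)" and "f \<in> cyclic_subspace C f"
proof -
  let ?O = "{(C ^^ n) f | n. True}"
  have sub: "cfun.span ?O \<subseteq> hardy_space"
    by (rule cfun.span_minimal) (auto simp: C_def comp_op_power_hardy[OF a f] subspace_hardy_space)
  have "cfun.span ?O \<subseteq> {x. C x \<in> cfun.span ?O}"
  proof (rule cfun.span_minimal)
    show "?O \<subseteq> {x. C x \<in> cfun.span ?O}"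
    proof clarify
      fix n
      have "C ((C ^^ n) f) = (C ^^ Suc n) f" by simp
      then have "C ((C ^^ n) f) \<in> ?O" by blast
      then show "C ((C ^^ n) f) \<in> cfun.span ?O" by (rule cfun.span_base)
    qed
    show "cfun.subspace {x. C x \<in> cfun.span ?O}"
      by (rule cfun.subspaceI)
         (auto simp: C_def comp_op_add comp_op_scale comp_op_zero
               intro: cfun.span_add cfun.span_scale cfun.span_zero)
  qed
  then show "invariant_subspace C (cyclic_subspace C f)"
    unfolding cyclic_subspace_def using sub a unfolding C_def
    by (intro invariant_subspace_closure cfun.subspace_span) auto
  have "(C ^^ 0) f \<in> ?O" by blast
  then have "f \<in> cfun.span ?O" by (intro cfun.span_base) simp
  then show "f \<in> cyclic_subspace C f"
    unfolding cyclic_subspace_def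
    using closure_of_subset[of "cfun.span ?O" hardy.mtopology] sub by auto
qed

lemma cyclic_subspace_power_subset: "cyclic_subspace T ((T ^^ n) f) \<subseteq> cyclic_subspace T f"
proof -
  have "(T ^^ k) ((T ^^ n) f) \<in> {(T ^^ m) f | m. True}" for k
    by (auto simp flip: comp_apply[of "T ^^ k" "T ^^ n"] funpow_add)
  then show ?thesis
    unfolding cyclic_subspace_def by (intro closure_of_mono cfun.span_mono) auto
qed

section \<open>The singular subspaces\<close>

lemma singular_subspace_altdef: "singular_subspace b = singular_mult b ` hardy_space"
  by (auto simp: singular_subspace_def singular_inner_def)

lemma singular_subspaceI: "h \<in> hardy_space \<Longrightarrow> singular_mult b h \<in> singular_subspace b"
  unfolding singular_subspace_altdef by (rule imageI)

lemma singular_subspace_subset_hardy: "b \<ge> 0 \<Longrightarrow> singular_subspace b \<subseteq> hardy_space"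
  by (auto simp: singular_subspace_altdef singular_mult_hardy)

lemma subspace_singular_subspace: "cfun.subspace (singular_subspace b)"
proof (rule cfun.subspaceI)
  show "0 \<in> singular_subspace b"
    using cfun.subspace_0[OF subspace_hardy_space]
    by (auto simp: singular_subspace_altdef fun_eq_iff intro!: image_eqI[of _ _ 0])
next
  fix x y assume "x \<in> singular_subspace b" "y \<in> singular_subspace b"
  then obtain g h where gh: "g \<in> hardy_space" "h \<in> hardy_space"
      and "x = singular_mult b g" "y = singular_mult b h"
    by (auto simp: singular_subspace_altdef)
  then have "x + y = singular_mult b (g + h)"
    by (simp add: fun_eq_iff algebra_simps)
  then show "x + y \<in> singular_subspace b"
    using singular_subspaceI[OF hardy_add(1)[OF gh]] by (simp only:)
next
  fix c x assume "x \<in> singular_subspace b"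
  then obtain h where h: "h \<in> hardy_space" and "x = singular_mult b h"
    by (auto simp: singular_subspace_altdef)
  then have "(\<lambda>z. c * x z) = singular_mult b (\<lambda>z. c * h z)"
    by (simp add: fun_eq_iff)
  then show "(\<lambda>z. c * x z) \<in> singular_subspace b"
    using singular_subspaceI[OF hardy_scale(1)[OF h]] by (simp only:)
qed

lemma singular_subspace_antimono:
  assumes "b \<le> c" shows "singular_subspace c \<subseteq> singular_subspace b"
proof
  fix x assume "x \<in> singular_subspace c"
  then obtain h where h: "h \<in> hardy_space" and "x = singular_mult c h"
    by (auto simp: singular_subspace_altdef)
  then have "x = singular_mult b (singular_mult (c - b) h)"
    by (simp add: fun_eq_iff singular_inner_def exp_add[symmetric] algebra_simps flip: mult.assoc)
  moreover have "singular_mult (c - b) h \<in> hardy_space"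
    using assms h by (intro singular_mult_hardy) auto
  ultimately show "x \<in> singular_subspace b"
    using singular_subspaceI[of "singular_mult (c - b) h" b] by (simp only:)
qed

text \<open>
  In the half-plane coordinate \<open>w = (1 + z) / (1 - z)\<close> the affine symbol is
  \<open>w / a + (1 - a) / a\<close>. Hence the exponent is divided by \<open>a\<close>, up to a constant factor.
\<close>
lemma singular_inner_affine:
  assumes a: "0 < a" and z: "z \<noteq> 1"
  shows "singular_inner b (affine_symbol a z) =
         exp (- of_real (b * (1 - a) / a)) * singular_inner (b / a) z"
proof -
  have "affine_symbol a z - 1 = of_real a * (z - 1)"
    by (simp add: affine_symbol_def algebra_simps)
  then have "(affine_symbol a z + 1) / (affine_symbol a z - 1) =
        (of_real a * z + (1 - of_real a) + 1) / (of_real a * (z - 1))"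
    by (simp add: affine_symbol_def)
  also have "\<dots> = (z + 1) / (z - 1) / of_real a - (1 - of_real a) / of_real a"
    using a z by (simp add: divide_simps) (simp add: algebra_simps)
  finally have eq: "(affine_symbol a z + 1) / (affine_symbol a z - 1) =
        (z + 1) / (z - 1) / of_real a - (1 - of_real a) / of_real a" .
  have "of_real b * (w / of_real a - (1 - of_real a) / of_real a) =
        - of_real (b * (1 - a) / a) + of_real (b / a) * w" for w :: complex
    by (simp add: algebra_simps diff_divide_distrib)
  then have "of_real b * ((affine_symbol a z + 1) / (affine_symbol a z - 1)) =
        - of_real (b * (1 - a) / a) + of_real (b / a) * ((z + 1) / (z - 1))"
    unfolding eq .
  then show ?thesis
    by (simp only: singular_inner_def exp_add)
qed

lemma comp_op_singular_subspace:
  assumes a: "0 < a" "a < 1" and f: "f \<in> singular_subspace b"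
  shows "comp_op (affine_symbol a) f \<in> singular_subspace (b / a)"
proof -
  obtain h where h: "h \<in> hardy_space" and fh: "f = singular_mult b h"
    using f by (auto simp: singular_subspace_altdef)
  let ?h = "\<lambda>z. exp (- of_real (b * (1 - a) / a)) * comp_op (affine_symbol a) h z"
  have "comp_op (affine_symbol a) f = singular_mult (b / a) ?h"
  proof
    fix z
    show "comp_op (affine_symbol a) f z = singular_mult (b / a) ?h z"
    proof (cases "z \<in> unit_disk")
      case True
      then have "z \<noteq> 1" by auto
      with True show ?thesis
        unfolding fh comp_op_def singular_inner_affine[OF a(1) \<open>z \<noteq> 1\<close>] by (simp only: if_True mult_ac)
    qed (simp add: comp_op_def)
  qed
  then show ?thesis
    using singular_subspaceI[OF hardy_scale(1)[OF comp_op_hardy(1)[OF a h]]] by (simp only:)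
qed

lemma comp_op_power_singular_subspace:
  assumes a: "0 < a" "a < 1" and f: "f \<in> singular_subspace b"
  shows "(comp_op (affine_symbol a) ^^ n) f \<in> singular_subspace (b / a ^ n)"
proof (induction n)
  case (Suc n)
  then show ?case
    using comp_op_singular_subspace[OF a Suc.IH] by (simp add: mult.commute)
qed (simp add: f)

text \<open>
  The quotient by the singular inner function has the same norm, and its value is bounded by that
  norm. The decisive point is that the constant does not depend on \<open>b\<close> except through the singular inner
  function at \<open>z\<close>.
\<close>
lemma singular_subspace_eval_bound:
  assumes b: "b \<ge> 0" and f: "f \<in> singular_subspace b" and z: "cmod z < 1"
  shows "cmod (f z) \<le> cmod (singular_inner b z) * hardy_norm f / (1 - cmod z)"
proof -
  obtain h where h: "h \<in> hardy_space" and fh: "f = singular_mult b h"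
    using f by (auto simp: singular_subspace_altdef)
  have "cmod (h z) \<le> hardy_norm h / (1 - cmod z)"
    by (rule hardy_eval_bound[OF h z])
  also have "\<dots> \<le> hardy_norm f / (1 - cmod z)"
    using hardy_norm_singular_mult[OF b h] z unfolding fh by (intro divide_right_mono) auto
  finally have "cmod (singular_inner b z) * cmod (h z) \<le>
      cmod (singular_inner b z) * (hardy_norm f / (1 - cmod z))"
    by (intro mult_left_mono) auto
  then show ?thesis by (simp add: fh norm_mult)
qed

text \<open>
  The estimate survives limits because both of its sides are continuous in the norm. It replaces the
  closedness of the singular subspace.
\<close>
lemma singular_closure_eval_bound:
  assumes b: "b \<ge> 0" and S: "S \<subseteq> singular_subspace b"
    and f: "f \<in> hardy.mtopology closure_of S" and z: "cmod z < 1"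
  shows "cmod (f z) \<le> cmod (singular_inner b z) * hardy_norm f / (1 - cmod z)"
proof (rule field_le_epsilon)
  fix e :: real assume e: "e > 0"
  have SH: "S \<subseteq> hardy_space"
    using S singular_subspace_subset_hardy[OF b] by blast
  define d where "d = e * (1 - cmod z) / 2"
  let ?s = "cmod (singular_inner b z)"
  have "d > 0" using e z by (simp add: d_def)
  then obtain y where y: "y \<in> S" "hardy_norm (f - y) < d"
    using f unfolding hardy_closure_iff[OF SH] by blast
  have H: "f \<in> hardy_space" "y \<in> hardy_space" "f - y \<in> hardy_space"
    using f y SH hardy_space_diff by (auto simp: hardy_closure_iff[OF SH])
  have "hardy_norm y \<le> hardy_norm f + d"
    using hardy_reverse_triangle[OF H(1,3)] y(2)
      hardy_add(2)[OF H(1) hardy_scale(1)[OF H(3), of "-1"]] hardy_scale(2)[OF H(3), of "-1"]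
    by (simp add: plus_fun_def)
  moreover have "?s * d \<le> d"
    using norm_singular_inner_le_1[OF b z] \<open>d > 0\<close> by (simp add: mult_left_le_one_le)
  ultimately have "?s * hardy_norm y \<le> ?s * hardy_norm f + d"
    using mult_left_mono[of "hardy_norm y" "hardy_norm f + d" ?s]
    by (simp add: distrib_left)
  moreover have "cmod (f z) * (1 - cmod z) \<le> cmod (y z) * (1 - cmod z) + cmod ((f - y) z) * (1 - cmod z)"
    using norm_triangle_ineq[of "y z" "(f - y) z"] z
    by (simp add: mult_right_mono flip: distrib_right)
  moreover have "cmod (y z) * (1 - cmod z) \<le> ?s * hardy_norm y"
    using singular_subspace_eval_bound[OF b _ z, of y] y(1) S z by (auto simp: pos_le_divide_eq)
  moreover have "cmod ((f - y) z) * (1 - cmod z) \<le> d"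
    using hardy_eval_bound[OF H(3) z] y(2) z by (simp add: pos_le_divide_eq)
  ultimately have "cmod (f z) * (1 - cmod z) \<le> ?s * hardy_norm f + e * (1 - cmod z)"
    by (simp add: d_def)
  then show "cmod (f z) \<le> ?s * hardy_norm f / (1 - cmod z) + e"
    using z by (simp add: field_simps)
qed

section \<open>Cyclic subspaces that are not minimal\<close>

theorem theorem21:
  fixes a b :: real and f :: "complex \<Rightarrow> complex"
  assumes "0 < a" and "a < 1" and "b > 0"
    and "f \<in> singular_subspace b" and "f \<noteq> 0"
  shows "\<not> minimal_invariant_subspace (comp_op (affine_symbol a))
             (cyclic_subspace (comp_op (affine_symbol a)) f)"
proof
  let ?C = "comp_op (affine_symbol a)"
  assume min: "minimal_invariant_subspace ?C (cyclic_subspace ?C f)"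
  note a = assms(1,2)
  have f: "f \<in> hardy_space"
    using singular_subspace_subset_hardy[of b] assms by auto
  note CH = comp_op_power_hardy[OF a f]
  have nz: "(?C ^^ n) f \<noteq> 0" for n
  proof (induction n)
    case (Suc n)
    then show ?case
      using comp_op_affine_injective[OF a CH[of n]] by (metis comp_apply funpow.simps(2))
  qed (use \<open>f \<noteq> 0\<close> in \<open>simp only: funpow.simps id_apply not_False_eq_True\<close>)
  have bound: "cmod (f z) \<le> cmod (singular_inner (b / a ^ n) z) * hardy_norm f / (1 - cmod z)"
    if z: "cmod z < 1" for n z
  proof -
    let ?g = "(?C ^^ n) f" and ?c = "b / a ^ n"
    have c: "?c \<ge> 0" using assms by simp
    have "cyclic_subspace ?C ?g \<noteq> {0}"
      using cyclic_subspace_properties(2)[OF a CH] nz by blast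
    \<comment> \<open>Minimality forces the smaller cyclic subspace to be all of the given one, so the function itself is
        approximated by elements of a singular subspace with a large parameter.\<close>
    then have "cyclic_subspace ?C ?g = cyclic_subspace ?C f"
      using min cyclic_subspace_properties(1)[OF a CH] cyclic_subspace_power_subset[of ?C n f]
      unfolding minimal_invariant_subspace_def by blast
    then have "f \<in> cyclic_subspace ?C ?g"
      using cyclic_subspace_properties(2)[OF a f] by simp
    moreover have "(?C ^^ k) ?g \<in> singular_subspace ?c" for k
    proof -
      have "a ^ k \<le> 1" using a by (simp add: power_le_one)
      then have "?c \<le> ?c / a ^ k"
        using a c mult_left_le[of "a ^ k" ?c] by (simp add: pos_le_divide_eq)
      then show ?thesis
        using comp_op_power_singular_subspace[OF a comp_op_power_singular_subspace[OF a assms(4)]]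
              singular_subspace_antimono by blast
    qed
    then have "cfun.span {(?C ^^ k) ?g | k. True} \<subseteq> singular_subspace ?c"
      by (intro cfun.span_minimal subspace_singular_subspace) auto
    ultimately show ?thesis
      using singular_closure_eval_bound[OF c _ _ z] unfolding cyclic_subspace_def by blast
  qed
  have "f z = 0" for z
  proof (cases "cmod z < 1")
    case z: True
    \<comment> \<open>The Poisson kernel at \<open>z\<close>, which is the rate of decay in the parameter.\<close>
    define p where "p = (1 - (cmod z)\<^sup>2) / (cmod (z - 1))\<^sup>2"
    have "(cmod z)\<^sup>2 < 1" using z by (simp add: power_less_one_iff abs_square_less_1)
    moreover have "z \<noteq> 1" using z by auto
    ultimately have p: "p > 0" by (simp add: p_def)
    have "filterlim (\<lambda>n. (b * p) * (1 / a) ^ n) at_top sequentially"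
    proof (rule filterlim_tendsto_pos_mult_at_top[OF tendsto_const])
      have "filterlim (\<lambda>n. norm ((1 / a) ^ n)) at_top sequentially"
        using a by (intro filterlim_at_infinity_imp_norm_at_top filterlim_realpow_sequentially_gt1) simp
      then show "filterlim (\<lambda>n. (1 / a) ^ n) at_top sequentially"
        using a by (simp add: norm_power)
    qed (use assms p in simp)
    then have "filterlim (\<lambda>n. - ((b * p) * (1 / a) ^ n)) at_bot sequentially"
      by (simp add: filterlim_uminus_at_bot)
    then have "(\<lambda>n. exp (- ((b * p) * (1 / a) ^ n))) \<longlonglongrightarrow> 0"
      by (rule filterlim_compose[OF exp_at_bot])
    moreover have "exp (- ((b * p) * (1 / a) ^ n)) = cmod (singular_inner (b / a ^ n) z)" for n
      by (simp add: norm_singular_inner p_def power_divide)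
    ultimately have "(\<lambda>n. cmod (singular_inner (b / a ^ n) z)) \<longlonglongrightarrow> 0"
      by simp
    then have "(\<lambda>n. cmod (singular_inner (b / a ^ n) z) * hardy_norm f / (1 - cmod z))
        \<longlonglongrightarrow> 0 * hardy_norm f / (1 - cmod z)"
      using z by (intro tendsto_intros) auto
    then have "cmod (f z) \<le> 0 * hardy_norm f / (1 - cmod z)"
      by (rule LIMSEQ_le_const) (use bound[OF z] in blast)
    then show ?thesis by simp
  qed (use f in \<open>auto simp: hardy_space_def\<close>)
  with \<open>f \<noteq> 0\<close> show False by (simp add: fun_eq_iff)
qed

end
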